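(* Let $1<p<\infty$, $\lambda_1,\dots,\lambda_N>0$ with $\sum_{i=1}^N\lambda_i=1$, and $\mu_1,\dots,\mu_N\in\mathcal{P}_p(\mathbb{R}^d)$ with $\mu_1\ll\mathcal{L}^d$. If $\nu_p$ is the $p$-Wasserstein barycenter of $(\mu_i,\lambda_i)_{i=1,\dots,N}$, then $$\overline{x}_p\circ(R_1,\dots,R_N)=\mathrm{id}\qquad\nu_p\text{-a.e.},$$ where, for $i=1,\dots,N$, $R_i:\operatorname{spt}\nu_p\to\operatorname{spt}\mu_i$ is the optimal transport map from $\nu_p$ to $\mu_i$ for the cost $\lambda_iW_p^p(\mu_i,\nu_p)$.
   Context: $\mathcal{L}^d$ is Lebesgue measure; $\mathcal{P}_p(\mathbb{R}^d)$ is the set of Borel probability measures with finite $p$-th moment; $W_p$ is the $p$-Wasserstein distance. The $p$-Wasserstein barycenter of $(\mu_i,\lambda_i)_i$ is the minimizer of $\nu\mapsto\sum_i\lambda_iW_p^p(\mu_i,\nu)$ over $\mathcal{P}_p(\mathbb{R}^d)$; since $\mu_1\ll\mathcal{L}^d$, it is unique and absolutely continuous, so that for each $i$ the optimal transport map $R_i$ from $\nu_p$ to $\mu_i$ (i.e. $(R_i)_\#\nu_p=\mu_i$ and $\int|z-R_i(z)|^p\,d\nu_p(z)=W_p^p(\mu_i,\nu_p)$) exists and is unique $\nu_p$-a.e. For $x_1,\dots,x_N\in\mathbb{R}^d$, $\overline{x}_p(x_1,\dots,x_N)$ is the unique minimizer of $z\mapsto\sum_i\lambda_i|x_i-z|^p$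 over $\mathbb{R}^d$. *)

theory Defs
  imports "HOL-Probability.Probability"
begin

definition prob_moment :: "real \<Rightarrow> 'a::euclidean_space measure set" where
  "prob_moment p = {\<mu>. prob_space \<mu> \<and> sets \<mu> = sets borel \<and>
     integrable \<mu> (\<lambda>x. norm x powr p)}"

definition couplings :: "'a::euclidean_space measure \<Rightarrow> 'a measure \<Rightarrow> ('a \<times> 'a) measure set" where
  "couplings \<mu> \<nu> = {\<gamma>. sets \<gamma> = sets borel \<and>
     distr \<gamma> borel fst = \<mu> \<and> distr \<gamma> borel snd = \<nu>}"

text \<open>The infimum is taken in the extended nonnegative reals. It is finite for measures in
  \<^const>\<open>prob_moment\<close>, so \<^const>\<open>enn2real\<close> loses nothing there; outside this set the value
  carries no meaning.\<close>

definition wasserstein :: "real \<Rightarrow> 'a::euclidean_space measure \<Rightarrow> 'a measure \<Rightarrow> real" where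
  "wasserstein p \<mu> \<nu> =
     enn2real (INF \<gamma>\<in>couplings \<mu> \<nu>. \<integral>\<^sup>+(x, y). ennreal (norm (x - y) powr p) \<partial>\<gamma>) powr (1 / p)"

definition is_wasserstein_barycenter ::
    "real \<Rightarrow> nat \<Rightarrow> (nat \<Rightarrow> real) \<Rightarrow> (nat \<Rightarrow> 'a::euclidean_space measure) \<Rightarrow> 'a measure \<Rightarrow> bool" where
  "is_wasserstein_barycenter p N l \<mu> \<nu> \<longleftrightarrow>
     is_arg_min (\<lambda>\<rho>. \<Sum>i=1..N. l i * wasserstein p (\<mu> i) \<rho> powr p) (\<lambda>\<rho>. \<rho> \<in> prob_moment p) \<nu>"

definition spt :: "'a::euclidean_space measure \<Rightarrow> 'a set" where
  "spt \<mu> = {x. \<forall>U. open U \<longrightarrow> x \<in> U \<longrightarrow> emeasure \<mu> U > 0}"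

text \<open>A map from \<open>spt \<nu>\<close> to \<open>spt \<mu>\<close> is represented by a Borel map on the whole space. As \<open>spt \<nu>\<close>
  is closed and of full \<open>\<nu>\<close>-measure, every Borel map on it has such an extension, and neither the
  push-forward nor the cost depends on the extension.\<close>

definition is_optimal_transport_map ::
    "real \<Rightarrow> 'a::euclidean_space measure \<Rightarrow> 'a measure \<Rightarrow> ('a \<Rightarrow> 'a) \<Rightarrow> bool" where
  "is_optimal_transport_map p \<nu> \<mu> R \<longleftrightarrow>
     R \<in> borel_measurable borel \<and> R \<in> spt \<nu> \<rightarrow> spt \<mu> \<and> distr \<nu> borel R = \<mu> \<and>
     (\<integral>\<^sup>+z. ennreal (norm (z - R z) powr p) \<partial>\<nu>) = ennreal (wasserstein p \<mu> \<nu> powr p)"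

definition point_barycenter ::
    "real \<Rightarrow> nat \<Rightarrow> (nat \<Rightarrow> real) \<Rightarrow> (nat \<Rightarrow> 'a::euclidean_space) \<Rightarrow> 'a" where
  "point_barycenter p N l x =
     (THE z. is_arg_min (\<lambda>z. \<Sum>i=1..N. l i * norm (x i - z) powr p) (\<lambda>_. True) z)"

end

theory Submission
  imports Defs
begin

text \<open>
  Put \<open>F z w = (\<Sum>i. \<lambda>\<^sub>i |R\<^sub>i z - w|\<^sup>p)\<close>. For a Borel map \<open>T\<close> the pair \<open>(R\<^sub>i, T)\<close> couples
  \<open>\<mu>\<^sub>i\<close> with \<open>T\<^sub>#\<nu>\<close>, so minimality of \<open>\<nu>\<close> and optimality of the \<open>R\<^sub>i\<close> give
  \<open>\<integral> F z z d\<nu> \<le> \<integral> F z (T z) d\<nu>\<close>. Hence no \<open>T\<close> of finite \<open>p\<close>-th moment can satisfy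
  \<open>F z (T z) \<le> F z z\<close> everywhere with strict inequality on a set of positive measure.
  Instead of the pointwise barycenter itself, whose measurability would need an argument, let
  \<open>T z\<close> be the first \<open>w\<close> in an enumerated countable dense set with \<open>F z w < F z z\<close>, and \<open>z\<close> if there
  is none. By continuity of \<open>F z\<close> the strict set is then exactly the set where \<open>z\<close> fails to minimize
  \<open>F z\<close>, and strict convexity makes minimizers unique.
\<close>

text \<open>The mean value theorem on the two halves of the interval compares two values of the
  derivative, which is strictly increasing because \<open>p - 1 > 0\<close>.\<close>

lemma powr_midpoint_less:
  fixes s t p :: real
  assumes "0 \<le> s" "s < t" "1 < p"
  shows "((s + t) / 2) powr p < (s powr p + t powr p) / 2"
proof -
  define m where "m = (s + t) / 2"
  have m: "s < m" "m < t" "m - s = (t - s) / 2" "t - m = (t - s) / 2"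
    using assms by (auto simp: m_def field_simps)
  have cont: "continuous_on {a..b} (\<lambda>x. x powr p)" if "0 \<le> a" for a b :: real
    using assms that by (intro continuous_on_powr' continuous_intros) auto
  have der: "((\<lambda>x. x powr p) has_real_derivative p * x powr (p - 1)) (at x)" if "0 < x" for x
    using that by (auto intro!: derivative_eq_intros)
  \<comment> \<open>The left half may start at \<open>s = 0\<close>, where \<open>der\<close> says
    nothing, so this half takes the version of the theorem that asks only for continuity at the
    endpoints.\<close>
  obtain u where u: "s < u" "u < m" "m powr p - s powr p = (m - s) * (p * u powr (p - 1))"
  proof -
    obtain k u where k: "s < u" "u < m" "((\<lambda>x. x powr p) has_real_derivative k) (at u)"
      "m powr p - s powr p = (m - s) * k"
      using MVT[OF m(1) cont[OF assms(1)]] der assms(1) real_differentiable_def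
      by (metis order_le_less_trans)
    moreover have "k = p * u powr (p - 1)"
      using k(1,3) der[of u] assms(1) by (auto intro: DERIV_unique)
    ultimately show thesis using that by blast
  qed
  obtain v where v: "m < v" "v < t" "t powr p - m powr p = (t - m) * (p * v powr (p - 1))"
    using MVT2[OF m(2), of "\<lambda>x. x powr p" "\<lambda>x. p * x powr (p - 1)"] der m assms(1) by force
  have "u powr (p - 1) < v powr (p - 1)"
    using u v assms by (intro powr_less_mono2) auto
  then have "m powr p - s powr p < t powr p - m powr p"
    unfolding u(3) v(3) m using assms by (intro mult_strict_left_mono) auto
  then show ?thesis by (simp add: m_def)
qed

text \<open>Strictness has two sources. For equal norms it is the parallelogram identity, in which
  \<open>a - b\<close> contributes a positive term; for different norms it is strict convexity of
  the power function.\<close>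

lemma norm_powr_midpoint_less:
  fixes a b :: "'a::real_inner"
  assumes "a \<noteq> b" "1 < p"
  shows "norm ((1/2) *\<^sub>R (a + b)) powr p < (norm a powr p + norm b powr p) / 2"
proof (cases "norm a = norm b")
  case True
  have "(norm ((1/2) *\<^sub>R (a + b)))\<^sup>2 + (norm ((1/2) *\<^sub>R (a - b)))\<^sup>2 = ((norm a)\<^sup>2 + (norm b)\<^sup>2) / 2"
    by (simp add: power2_norm_eq_inner inner_add_left inner_add_right inner_diff_left
        inner_diff_right inner_commute field_simps)
  also have "\<dots> = (norm a)\<^sup>2"
    by (simp add: True)
  finally have "(norm ((1/2) *\<^sub>R (a + b)))\<^sup>2 < (norm a)\<^sup>2"
    using assms(1) by (smt (verit) right_minus_eq scaleR_eq_0_iff zero_less_norm_iff zero_less_power divide_eq_0_iff)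
  then have "norm ((1/2) *\<^sub>R (a + b)) < norm a"
    by (rule power2_less_imp_less) simp
  then show ?thesis
    using True assms powr_less_mono2[of p "norm ((1/2) *\<^sub>R (a + b))" "norm a"] by simp
next
  case False
  have "norm ((1/2) *\<^sub>R (a + b)) \<le> (norm a + norm b) / 2"
    using norm_triangle_ineq[of a b] by simp
  then have "norm ((1/2) *\<^sub>R (a + b)) powr p \<le> ((norm a + norm b) / 2) powr p"
    using assms by (intro powr_mono2) auto
  also have "\<dots> < (norm a powr p + norm b powr p) / 2"
    using False powr_midpoint_less[of "norm a" "norm b" p] powr_midpoint_less[of "norm b" "norm a" p]
      assms by (cases "norm a < norm b") (auto simp: add.commute)
  finally show ?thesis .
qed

text \<open>The midpoint of two distinct minimizers would have strictly smaller cost. Since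
  \<open>z\<close> is given as a minimizer, existence comes for free and only uniqueness is left for
  \<open>THE\<close>.\<close>

lemma point_barycenter_eqI:
  fixes x :: "nat \<Rightarrow> 'a::euclidean_space"
  assumes p: "1 < p" and l: "\<And>i. i \<in> {1..N} \<Longrightarrow> 0 < l i" and N: "1 \<le> N"
    and min: "\<And>w. (\<Sum>i=1..N. l i * norm (x i - z) powr p) \<le> (\<Sum>i=1..N. l i * norm (x i - w) powr p)"
  shows "point_barycenter p N l x = z"
  unfolding point_barycenter_def
proof (rule the_equality)
  show "is_arg_min (\<lambda>z. \<Sum>i=1..N. l i * norm (x i - z) powr p) (\<lambda>_. True) z"
    using min by (auto simp: is_arg_min_def not_less)
next
  fix w
  let ?f = "\<lambda>z. \<Sum>i=1..N. l i * norm (x i - z) powr p"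
  let ?m = "(1/2) *\<^sub>R (z + w)"
  assume "is_arg_min ?f (\<lambda>_. True) w"
  then have w: "?f w \<le> ?f z"
    by (auto simp: is_arg_min_def not_less)
  show "w = z"
  proof (rule ccontr)
    assume "w \<noteq> z"
    \<comment> \<open>Termwise strict inequalities survive summation because the index set is
      nonempty and the weights are positive.\<close>
    have "?f ?m < (\<Sum>i=1..N. l i * ((norm (x i - z) powr p + norm (x i - w) powr p) / 2))"
    proof (rule sum_strict_mono)
      fix i assume i: "i \<in> {1..N}"
      have "x i - ?m = (1/2) *\<^sub>R ((x i - z) + (x i - w))"
        by (simp add: algebra_simps flip: scaleR_add_left)
      then show "l i * norm (x i - ?m) powr p
          < l i * ((norm (x i - z) powr p + norm (x i - w) powr p) / 2)"
        using norm_powr_midpoint_less[of "x i - z" "x i - w" p] \<open>w \<noteq> z\<close> p l[OF i] by simp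
    qed (use N in auto)
    also have "\<dots> = (?f z + ?f w) / 2"
      by (simp add: distrib_left sum.distrib add_divide_distrib sum_divide_distrib)
    finally show False
      using w min[of ?m] by simp
  qed
qed

text \<open>The image of \<open>\<nu>\<close> under \<open>(R, T)\<close> is a coupling, and the
  right-hand side is its cost. Stating this in \<open>ennreal\<close> allows that cost to be
  infinite.\<close>

lemma wasserstein_powr_le_cost:
  fixes \<nu> :: "'a::euclidean_space measure" and R T :: "'a \<Rightarrow> 'a"
  assumes "0 < p" "sets \<nu> = sets borel" "R \<in> borel_measurable borel" "T \<in> borel_measurable borel"
  shows "ennreal (wasserstein p (distr \<nu> borel R) (distr \<nu> borel T) powr p)
    \<le> (\<integral>\<^sup>+z. ennreal (norm (R z - T z) powr p) \<partial>\<nu>)"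
proof -
  have [measurable_cong]: "sets \<nu> = sets borel" by fact
  note [measurable] = assms(3,4)
  let ?\<gamma> = "distr \<nu> borel (\<lambda>z. (R z, T z))"
  let ?c = "\<lambda>\<gamma>. \<integral>\<^sup>+(x, y). ennreal (norm (x - y :: 'a) powr p) \<partial>\<gamma>"
  let ?C = "couplings (distr \<nu> borel R) (distr \<nu> borel T)"
  have "?\<gamma> \<in> ?C"
    unfolding couplings_def by (simp add: distr_distr comp_def borel_prod[symmetric])
  then have "(INF \<gamma>\<in>?C. ?c \<gamma>) \<le> ?c ?\<gamma>"
    by (rule INF_lower)
  also have "?c ?\<gamma> = (\<integral>\<^sup>+z. ennreal (norm (R z - T z) powr p) \<partial>\<nu>)"
    by (subst nn_integral_distr) (auto simp: borel_prod[symmetric])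
  finally have le: "(INF \<gamma>\<in>?C. ?c \<gamma>) \<le> (\<integral>\<^sup>+z. ennreal (norm (R z - T z) powr p) \<partial>\<nu>)" .
  have "wasserstein p (distr \<nu> borel R) (distr \<nu> borel T) powr p = enn2real (INF \<gamma>\<in>?C. ?c \<gamma>)"
    using assms(1) by (simp add: wasserstein_def powr_powr)
  \<comment> \<open>\<open>enn2real\<close> sends infinity to 0, so only this inequality holds in
    general; it is the direction required.\<close>
  moreover have "ennreal (enn2real a) \<le> a" for a
    by (cases a) auto
  ultimately have "ennreal (wasserstein p (distr \<nu> borel R) (distr \<nu> borel T) powr p)
      \<le> (INF \<gamma>\<in>?C. ?c \<gamma>)"
    by presburger
  then show ?thesis
    using le by (rule order_trans)
qed

text \<open>A crude triangle inequality for p-th powers, from \<open>norm b \<le> 2 * M\<close> with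
  \<open>M\<close> the larger of the two norms. It will bound the moment of the competitor
  map.\<close>

lemma norm_powr_le_shifted:
  fixes a b :: "'a::real_normed_vector"
  assumes "0 \<le> p"
  shows "norm b powr p \<le> 2 powr p * (norm a powr p + norm (a - b) powr p)"
proof -
  define M where "M = max (norm a) (norm (a - b))"
  have "norm b \<le> 2 * M"
    using norm_triangle_ineq4[of a "a - b"] by (simp add: M_def)
  then have "norm b powr p \<le> (2 * M) powr p"
    using assms by (intro powr_mono2) auto
  also have "\<dots> = 2 powr p * M powr p"
    by (simp add: powr_mult M_def)
  also have "M powr p \<le> norm a powr p + norm (a - b) powr p"
    by (simp add: M_def max_def)
  finally show ?thesis by simp
qed

lemma sum_ennreal_mult:
  assumes "\<And>i. i \<in> I \<Longrightarrow> 0 \<le> a i" "\<And>i. i \<in> I \<Longrightarrow> 0 \<le> b i"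
  shows "(\<Sum>i\<in>I. ennreal (a i) * ennreal (b i)) = ennreal (\<Sum>i\<in>I. a i * b i)"
  using assms by (subst sum_ennreal[symmetric]) (auto intro!: sum.cong simp: ennreal_mult)

lemma AE_point_barycenter:
  fixes \<nu> :: "'a::euclidean_space measure"
  assumes p: "1 < p" and l: "\<And>i. i \<in> {1..N} \<Longrightarrow> 0 < l i" and N: "1 \<le> N"
    and mu: "\<mu> 1 \<in> prob_moment p"
    and bary: "is_wasserstein_barycenter p N l \<mu> \<nu>"
    and R: "\<And>i. i \<in> {1..N} \<Longrightarrow> is_optimal_transport_map p \<nu> (\<mu> i) (R i)"
  shows "AE z in \<nu>. point_barycenter p N l (\<lambda>i. R i z) = z"
proof -
  have nu: "\<nu> \<in> prob_moment p"
    using bary by (simp add: is_wasserstein_barycenter_def is_arg_min_def)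
  have sets_nu [measurable_cong]: "sets \<nu> = sets borel"
    using nu by (simp add: prob_moment_def)
  interpret prob_space \<nu>
    using nu by (simp add: prob_moment_def)
  have Rm [measurable]: "R i \<in> borel_measurable borel" if "i \<in> {1..N}" for i
    using R[OF that] by (simp add: is_optimal_transport_map_def)
  have Rd: "distr \<nu> borel (R i) = \<mu> i" if "i \<in> {1..N}" for i
    using R[OF that] by (simp add: is_optimal_transport_map_def)
  have Rc: "(\<integral>\<^sup>+z. ennreal (norm (R i z - z) powr p) \<partial>\<nu>) = ennreal (wasserstein p (\<mu> i) \<nu> powr p)"
    if "i \<in> {1..N}" for i
    using R[OF that] by (simp add: is_optimal_transport_map_def norm_minus_commute)
  define F where "F z w = (\<Sum>i=1..N. l i * norm (R i z - w) powr p)" for z w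
  have l0: "0 \<le> l i" if "i \<in> {1..N}" for i
    using l[OF that] by simp
  have F_nonneg: "0 \<le> F z w" for z w
    unfolding F_def using l0 by (intro sum_nonneg mult_nonneg_nonneg) auto
  have F_meas [measurable]: "(\<lambda>z. F z (T z)) \<in> borel_measurable borel"
    if [measurable]: "T \<in> borel_measurable borel" for T
    unfolding F_def by measurable
  have F_integral: "(\<integral>\<^sup>+z. ennreal (F z (T z)) \<partial>\<nu>)
      = (\<Sum>i=1..N. ennreal (l i) * (\<integral>\<^sup>+z. ennreal (norm (R i z - T z) powr p) \<partial>\<nu>))"
    if [measurable]: "T \<in> borel_measurable borel" for T
  proof -
    have "(\<integral>\<^sup>+z. ennreal (F z (T z)) \<partial>\<nu>)
        = (\<integral>\<^sup>+z. (\<Sum>i=1..N. ennreal (l i) * ennreal (norm (R i z - T z) powr p)) \<partial>\<nu>)"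
      unfolding F_def using l0
      by (intro nn_integral_cong sum_ennreal_mult[symmetric]) auto
    also have "\<dots> = (\<Sum>i=1..N. \<integral>\<^sup>+z. ennreal (l i) * ennreal (norm (R i z - T z) powr p) \<partial>\<nu>)"
      by (rule nn_integral_sum) measurable
    also have "\<dots> = (\<Sum>i=1..N. ennreal (l i) * (\<integral>\<^sup>+z. ennreal (norm (R i z - T z) powr p) \<partial>\<nu>))"
      by (intro sum.cong nn_integral_cmult) measurable
    finally show ?thesis .
  qed
  \<comment> \<open>Optimality of the maps \<open>R i\<close> makes this an equality; its right-hand
    side is a real number, hence the integrability in \<open>F_int\<close>.\<close>
  have F_diag: "(\<integral>\<^sup>+z. ennreal (F z z) \<partial>\<nu>) = ennreal (\<Sum>i=1..N. l i * wasserstein p (\<mu> i) \<nu> powr p)"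
    unfolding F_integral[of "\<lambda>z. z", simplified] using l0
    by (subst sum_ennreal_mult[symmetric]) (auto intro!: sum.cong simp: Rc)
  have F_int: "integrable \<nu> (\<lambda>z. F z z)"
    using F_diag F_nonneg by (intro integrableI_nonneg) auto
  have cont: "isCont (F z) w" for z w
  proof -
    have "continuous_on UNIV (F z)"
      unfolding F_def using p by (intro continuous_on_powr' continuous_intros) auto
    then show ?thesis by (simp add: continuous_on_eq_continuous_at)
  qed

  obtain D :: "'a set" where D: "countable D" "\<And>X. open X \<Longrightarrow> X \<noteq> {} \<Longrightarrow> \<exists>d\<in>D. d \<in> X"
    using countable_dense_exists by blast
  define d where "d = from_nat_into D"
  \<comment> \<open>If no \<open>n\<close> qualifies, \<open>LEAST\<close> yields an unspecified
    index; this is why \<open>T\<close> tests the inequality again before using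
    \<open>d (g z)\<close>.\<close>
  define g where "g z = (LEAST n. F z (d n) < F z z)" for z
  define T where "T z = (if F z (d (g z)) < F z z then d (g z) else z)" for z
  have g [measurable]: "g \<in> borel \<rightarrow>\<^sub>M count_space UNIV"
    unfolding g_def by measurable
  \<comment> \<open>\<open>T\<close> is glued from countably many Borel maps, selected by the
    measurable index \<open>g\<close>.\<close>
  have T [measurable]: "T \<in> borel_measurable borel"
    unfolding T_def
    by (rule measurable_compose_countable[where g = g and f = "\<lambda>n z. if F z (d n) < F z z then d n else z"])
      measurable
  have T_le: "F z (T z) \<le> F z z" for z
    by (simp add: T_def)
  have T_less: "F z (T z) < F z z" if less: "F z w < F z z" for z w
  proof -
    have "\<forall>\<^sub>F u in nhds w. F z u < F z z"
      using cont[of w z] less by (simp add: isCont_def tendsto_at_iff_tendsto_nhds order_tendstoD)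
    then obtain U where "open U" "w \<in> U" and U: "\<And>u. u \<in> U \<Longrightarrow> F z u < F z z"
      by (auto simp: eventually_nhds)
    then obtain u where u: "u \<in> D" "u \<in> U"
      using D(2)[of U] by blast
    then obtain n where "d n = u"
      using from_nat_into_surj[OF D(1)] by (auto simp: d_def)
    then have "F z (d n) < F z z"
      using U u by simp
    then have "F z (d (g z)) < F z z"
      unfolding g_def by (rule LeastI)
    then show ?thesis by (simp add: T_def)
  qed

  \<comment> \<open>This makes the image of \<open>\<nu>\<close> under \<open>T\<close> an
    admissible competitor. The point \<open>T z\<close> is compared with \<open>R 1 z\<close>, whose
    p-th moment is that of \<open>\<mu> 1\<close>; their distance is controlled by
    \<open>F z (T z) \<le> F z z\<close>.\<close>
  have "integrable \<nu> (\<lambda>z. norm (T z) powr p)"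
  proof (rule Bochner_Integration.integrable_bound)
    have "integrable (distr \<nu> borel (R 1)) (\<lambda>x. norm x powr p)"
      using mu N by (simp add: Rd prob_moment_def)
    then have "integrable \<nu> (\<lambda>z. norm (R 1 z) powr p)"
      using N by (subst (asm) integrable_distr_eq) auto
    then show "integrable \<nu> (\<lambda>z. 2 powr p * (norm (R 1 z) powr p + F z z / l 1))"
      using F_int by auto
    have "norm (T z) powr p \<le> 2 powr p * (norm (R 1 z) powr p + F z z / l 1)" for z
    proof -
      have "l 1 * norm (R 1 z - T z) powr p \<le> F z (T z)"
        unfolding F_def using l0 N
        by (intro member_le_sum[where f = "\<lambda>i. l i * norm (R i z - T z) powr p"])
          auto
      with T_le[of z] l[of 1] N have "norm (R 1 z - T z) powr p \<le> F z z / l 1"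
        by (simp add: field_simps)
      then have "2 powr p * (norm (R 1 z) powr p + norm (R 1 z - T z) powr p)
          \<le> 2 powr p * (norm (R 1 z) powr p + F z z / l 1)"
        by (intro mult_left_mono add_left_mono) auto
      then show ?thesis
        using norm_powr_le_shifted[of p "T z" "R 1 z"] p by linarith
    qed
    then show "AE z in \<nu>. norm (norm (T z) powr p)
        \<le> norm (2 powr p * (norm (R 1 z) powr p + F z z / l 1))"
      by (auto intro: order_trans[OF _ abs_ge_self])
  qed measurable
  then have "distr \<nu> borel T \<in> prob_moment p"
    by (simp add: prob_moment_def prob_space_distr integrable_distr_eq)
  then have "(\<Sum>i=1..N. l i * wasserstein p (\<mu> i) \<nu> powr p)
      \<le> (\<Sum>i=1..N. l i * wasserstein p (\<mu> i) (distr \<nu> borel T) powr p)"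
    using bary by (auto simp: is_wasserstein_barycenter_def is_arg_min_def not_less)
  then have "(\<integral>\<^sup>+z. ennreal (F z z) \<partial>\<nu>)
      \<le> ennreal (\<Sum>i=1..N. l i * wasserstein p (\<mu> i) (distr \<nu> borel T) powr p)"
    unfolding F_diag by (rule ennreal_leI)
  also have "\<dots> = (\<Sum>i=1..N. ennreal (l i) * ennreal (wasserstein p (\<mu> i) (distr \<nu> borel T) powr p))"
    by (intro sum_ennreal_mult[symmetric] l0) auto
  also have "\<dots> \<le> (\<Sum>i=1..N. ennreal (l i) * (\<integral>\<^sup>+z. ennreal (norm (R i z - T z) powr p) \<partial>\<nu>))"
  proof (intro sum_mono mult_left_mono)
    fix i assume i: "i \<in> {1..N}"
    show "ennreal (wasserstein p (\<mu> i) (distr \<nu> borel T) powr p)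
        \<le> (\<integral>\<^sup>+z. ennreal (norm (R i z - T z) powr p) \<partial>\<nu>)"
      using wasserstein_powr_le_cost[OF _ sets_nu Rm[OF i] T, of p] p Rd[OF i] by simp
  qed simp
  also have "\<dots> = (\<integral>\<^sup>+z. ennreal (F z (T z)) \<partial>\<nu>)"
    by (simp add: F_integral)
  finally have le: "(\<integral>\<^sup>+z. ennreal (F z z) \<partial>\<nu>) \<le> (\<integral>\<^sup>+z. ennreal (F z (T z)) \<partial>\<nu>)" .
  \<comment> \<open>With both integrals finite, the comparison passes to real integrals, where the
    two sides can be subtracted.\<close>
  have FT_int: "integrable \<nu> (\<lambda>z. F z (T z))"
    using T_le F_nonneg by (intro Bochner_Integration.integrable_bound[OF F_int]) auto
  have "(\<integral>z. F z z \<partial>\<nu>) \<le> (\<integral>z. F z (T z) \<partial>\<nu>)"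
    using le F_int FT_int F_nonneg by (simp add: nn_integral_eq_integral integral_nonneg)
  \<comment> \<open>The difference is pointwise nonnegative while its integral is at most 0, so it
    vanishes almost everywhere.\<close>
  moreover have "0 \<le> (\<integral>z. F z z - F z (T z) \<partial>\<nu>)"
    using T_le by (intro Bochner_Integration.integral_nonneg) simp
  ultimately have "(\<integral>z. F z z - F z (T z) \<partial>\<nu>) = 0"
    using F_int FT_int by simp
  then have "AE z in \<nu>. F z z - F z (T z) = 0"
    using integral_nonneg_eq_0_iff_AE[of \<nu> "\<lambda>z. F z z - F z (T z)"] F_int FT_int T_le by auto
  then show ?thesis
  proof eventually_elim
    case (elim z)
    \<comment> \<open>Contraposition of \<open>T_less\<close>: any better \<open>w\<close> would
      have made \<open>T\<close> strictly improve at \<open>z\<close>.\<close>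
    then have "F z z \<le> F z w" for w
      using T_less[of z w] by (auto simp: not_less[symmetric])
    then show ?case
      unfolding F_def using p l N by (intro point_barycenter_eqI) auto
  qed
qed

theorem proposition2p9:
  fixes p :: real and N :: nat and l :: "nat \<Rightarrow> real"
    and \<mu> :: "nat \<Rightarrow> (real ^ 'd) measure" and \<nu> :: "(real ^ 'd) measure"
    and R :: "nat \<Rightarrow> real ^ 'd \<Rightarrow> real ^ 'd"
  assumes "1 < p"
    and "\<And>i. i \<in> {1..N} \<Longrightarrow> 0 < l i"
    and "(\<Sum>i=1..N. l i) = 1"
    and "\<And>i. i \<in> {1..N} \<Longrightarrow> \<mu> i \<in> prob_moment p"
    and "absolutely_continuous lborel (\<mu> 1)"
    and "is_wasserstein_barycenter p N l \<mu> \<nu>"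
    and "\<And>i. i \<in> {1..N} \<Longrightarrow> is_optimal_transport_map p \<nu> (\<mu> i) (R i)"
  shows "AE z in \<nu>. point_barycenter p N l (\<lambda>i. R i z) = z"
proof -
  \<comment> \<open>For \<open>N = 0\<close> the weights would sum to 0 instead of 1.\<close>
  have "1 \<le> N"
    using assms(3) by (cases N) auto
  then show ?thesis
    using assms by (intro AE_point_barycenter) auto
qed

end
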